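(* The largest eigenvalue of the Perron operator is at a positive distance from the rest of its spectrum. Precisely: consider the normalized operator $\mathcal{F}$ on $\mathcal{L}^2(\theta)$ (which is conjugate, via multiplication by $e^{-\phi_{\epsilon,h}/(\epsilon h)}$ and scaling by $e^{\lambda_{\epsilon,h}/(\epsilon h)}$, to the operator $\mathcal{L}\varphi(x)=\int_{\mathbb{R}^n}e^{-L(x,v)/\epsilon}\varphi(x+hv)\,dv$, whose largest eigenvalue is $e^{-\lambda_{\epsilon,h}/(\epsilon h)}$ with eigenfunction $e^{-\phi_{\epsilon,h}/(\epsilon h)}$). Then $1$ is an eigenvalue of $\mathcal{F}$ whose eigenspace consists of the constants, and there exists $\delta>0$ such that $\mathcal{F}$ has no spectrum in $\{z\in\mathbb{C}:0<|z-1|<\delta\}$; in particular there is no sequence of eigenvalues $\lambda_p\to1$ of $\mathcal{F}$ with eigenfunctions $f_p$, $\|f_p\|_{\mathcal{L}^2(\theta)}=1$, $\int f_p\theta\,dx=0$.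
   Context: Let $\mathbb{T}^n=\mathbb{R}^n/\mathbb{Z}^n$; $x+hv$ is taken mod $\mathbb{Z}^n$. Let $L(x,v)=\frac12|v|^2-U(x)+\langle P,v\rangle$ with $U\in C^\infty(\mathbb{T}^n)$, $P\in\mathbb{R}^n$. Fix $\epsilon>0$, $h>0$. Let $\phi_{\epsilon,h},\bar\phi_{\epsilon,h}$ be differentiable functions on $\mathbb{T}^n$ and $\lambda_{\epsilon,h}\in\mathbb{R}$ with $-\epsilon h\ln\int_{\mathbb{R}^n}e^{-(hL(x,v)+\phi_{\epsilon,h}(x+hv))/(\epsilon h)}dv=\phi_{\epsilon,h}(x)+\lambda_{\epsilon,h}$ and $-\epsilon h\ln\int_{\mathbb{R}^n}e^{-(hL(x+hv,-v)+\bar\phi_{\epsilon,h}(x+hv))/(\epsilon h)}dv=\bar\phi_{\epsilon,h}(x)+\lambda_{\epsilon,h}$, normalized so that $\theta(x)=e^{-(\phi_{\epsilon,h}+\bar\phi_{\epsilon,h})/(\epsilon h)}$ is a probability density. It is known (assumed) that such solutions exist, and that the positive eigenfunction of the Perron operator is unique up to scaling (equivalently, every fixed point of $\mathcal{F}$ of the form $e^{-g}$ is constant). Define $\gamma(x,v)=e^{-(hL(x,v)+\phi_{\epsilon,h}(x+hv)-\phi_{\epsilon,h}(x)-\lambda_{\epsilon,h})/(\epsilon h)}$ and the normalized forward Perron operator $(\mathcal{F}g)(x)=\int_{\mathbb{R}^n}\gamma(x,v)g(x+hv)dv$, so $\mathcal{F}1=1$. $\mathcal{L}^2(\theta)=L^2(\mathbb{T}^n,\theta\,dx)$.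 *)

theory Defs
  imports "HOL-Analysis.Analysis"
begin

text \<open>Functions on the torus T^n = R^n / Z^n are represented as Z^n-periodic
functions on real^'n (dimension n = CARD('n)).\<close>

definition periodic_Zn :: "(real^'n \<Rightarrow> 'a) \<Rightarrow> bool" where
  "periodic_Zn f \<longleftrightarrow> (\<forall>x k. (\<forall>i. k $ i \<in> \<int>) \<longrightarrow> f (x + k) = f x)"

primrec Ck :: "nat \<Rightarrow> (real^'n \<Rightarrow> real) \<Rightarrow> bool" where
  "Ck 0 f \<longleftrightarrow> continuous_on UNIV f"
| "Ck (Suc k) f \<longleftrightarrow> (\<forall>x. f differentiable (at x)) \<and>
      (\<forall>v. Ck k (\<lambda>x. frechet_derivative f (at x) v))"

definition smooth_torus :: "(real^'n \<Rightarrow> real) \<Rightarrow> bool" where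
  "smooth_torus f \<longleftrightarrow> periodic_Zn f \<and> (\<forall>k. Ck k f)"

text \<open>Fundamental domain of the torus (Lebesgue measure restricted to it is the
Haar measure of T^n).\<close>
definition torus_cube :: "(real^'n) set" where
  "torus_cube = cbox 0 One"

definition Lag :: "(real^'n \<Rightarrow> real) \<Rightarrow> real^'n \<Rightarrow> real^'n \<Rightarrow> real^'n \<Rightarrow> real" where
  "Lag U P x v = (norm v)\<^sup>2 / 2 - U x + P \<bullet> v"

definition gam :: "(real^'n \<Rightarrow> real) \<Rightarrow> real^'n \<Rightarrow> real \<Rightarrow> real \<Rightarrow> (real^'n \<Rightarrow> real) \<Rightarrow> real
                   \<Rightarrow> real^'n \<Rightarrow> real^'n \<Rightarrow> real" where
  "gam U P eps h phi lam x v =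
     exp (- (h * Lag U P x v + phi (x + h *\<^sub>R v) - phi x - lam) / (eps * h))"

definition Fop :: "(real^'n \<Rightarrow> real) \<Rightarrow> real^'n \<Rightarrow> real \<Rightarrow> real \<Rightarrow> (real^'n \<Rightarrow> real) \<Rightarrow> real
                   \<Rightarrow> (real^'n \<Rightarrow> complex) \<Rightarrow> real^'n \<Rightarrow> complex" where
  "Fop U P eps h phi lam g x =
     (\<integral>v. complex_of_real (gam U P eps h phi lam x v) * g (x + h *\<^sub>R v) \<partial>lborel)"

definition L2w :: "(real^'n \<Rightarrow> real) \<Rightarrow> (real^'n \<Rightarrow> complex) \<Rightarrow> bool" where
  "L2w \<theta> f \<longleftrightarrow> periodic_Zn f \<and> f \<in> borel_measurable lborel \<and>
     set_integrable lborel torus_cube (\<lambda>x. \<theta> x * (cmod (f x))\<^sup>2)"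

definition L2w_norm :: "(real^'n \<Rightarrow> real) \<Rightarrow> (real^'n \<Rightarrow> complex) \<Rightarrow> real" where
  "L2w_norm \<theta> f = sqrt (LINT x:torus_cube|lborel. \<theta> x * (cmod (f x))\<^sup>2)"

text \<open>Equality in L^2(theta) (a.e. on the torus; theta > 0, so theta-null = Lebesgue-null).\<close>
definition ae_eq :: "(real^'n \<Rightarrow> complex) \<Rightarrow> (real^'n \<Rightarrow> complex) \<Rightarrow> bool" where
  "ae_eq f g \<longleftrightarrow> (AE x in lborel. x \<in> torus_cube \<longrightarrow> f x = g x)"

definition is_eigenvalue_L2 :: "(real^'n \<Rightarrow> real) \<Rightarrow> ((real^'n \<Rightarrow> complex) \<Rightarrow> real^'n \<Rightarrow> complex)
                               \<Rightarrow> complex \<Rightarrow> bool" where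
  "is_eigenvalue_L2 \<theta> T z \<longleftrightarrow>
     (\<exists>f. L2w \<theta> f \<and> \<not> ae_eq f (\<lambda>_. 0) \<and> ae_eq (T f) (\<lambda>x. z * f x))"

text \<open>Spectrum of a bounded operator T on L^2(theta): z is in the resolvent set iff
T - z I is a bijection of L^2(theta) (modulo a.e. equality); by the bounded inverse
theorem the inverse is then automatically bounded.\<close>
definition spectrum_L2 :: "(real^'n \<Rightarrow> real) \<Rightarrow> ((real^'n \<Rightarrow> complex) \<Rightarrow> real^'n \<Rightarrow> complex)
                           \<Rightarrow> complex set" where
  "spectrum_L2 \<theta> T = {z. \<not> ((\<forall>g. L2w \<theta> g \<longrightarrow>
        (\<exists>f. L2w \<theta> f \<and> ae_eq (\<lambda>x. T f x - z * f x) g)) \<and>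
      (\<forall>f. L2w \<theta> f \<longrightarrow> ae_eq (\<lambda>x. T f x - z * f x) (\<lambda>_. 0) \<longrightarrow> ae_eq f (\<lambda>_. 0)))}"

end

theory Submission
  imports Defs "HOL-Probability.Distributions"
begin

text \<open>
  The kernel \<open>\<gamma>\<close> has a Gaussian upper bound and, as a continuous positive function, a positive
  lower bound when \<open>x\<close> and \<open>x + h v\<close> lie in the unit cube. Hence \<open>F f = c \<integral> f + R f\<close> where the
  integral is over the torus and \<open>R\<close> is a positive operator with \<open>R 1 = 1 - c\<close> (Doeblin's condition), so
  \<open>R\<close> contracts the sup norm by \<open>1 - c\<close>. For \<open>|z| > 1 - c\<close> a Neumann series inverts \<open>R - z\<close> on
  bounded functions, and the rank-one term \<open>c \<integral> f\<close>, with values in the constants, only obstructs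
  inverting \<open>F - z\<close> at \<open>z = 1\<close>. Since \<open>F\<close> maps \<open>L\<^sup>1\<close> of the torus into the bounded functions,
  everything transfers to \<open>L\<^sup>2(\<theta>)\<close>: eigenfunctions are bounded, and \<open>(F - z) f = g\<close> is solved by
  \<open>f = u - g / z\<close> with \<open>u\<close> bounded and \<open>(F - z) u = F g / z\<close>.
\<close>

section \<open>Lattice tilings and translation invariance on the torus\<close>

lemma nn_integral_lborel_translate:
  fixes f :: "'a::euclidean_space \<Rightarrow> ennreal"
  assumes [measurable]: "f \<in> borel_measurable borel"
  shows "(\<integral>\<^sup>+x. f (x + a) \<partial>lborel) = (\<integral>\<^sup>+x. f x \<partial>lborel)"
proof -
  have "(\<integral>\<^sup>+x. f x \<partial>lborel) = (\<integral>\<^sup>+x. f x \<partial>distr lborel borel ((+) a))"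
    by (simp add: lborel_distr_plus)
  also have "\<dots> = (\<integral>\<^sup>+x. f (x + a) \<partial>lborel)"
    by (subst nn_integral_distr) (auto simp: add.commute)
  finally show ?thesis by simp
qed

text \<open>Integer vectors serve as indices because they are countable: a sum over the lattice
  becomes an integral over \<open>count_space UNIV\<close> that can be exchanged with a Lebesgue
  integral.\<close>

definition lattice_vec :: "int^'n \<Rightarrow> real^'n" where
  "lattice_vec k = (\<chi> i. of_int (k $ i))"

text \<open>This is \<open>[0,1)\<close> in every coordinate. Written with floors, the one translate
  of it that contains a given point has an explicit index, the vector of floors.\<close>

definition half_open_cube :: "(real^'n) set" where
  "half_open_cube = {x. \<forall>i. \<lfloor>x $ i\<rfloor> = 0}"

lemma half_open_cube_measurable [measurable]: "half_open_cube \<in> sets borel"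
  unfolding half_open_cube_def by measurable

lemma half_open_cube_translate_iff:
  "x - lattice_vec k \<in> half_open_cube \<longleftrightarrow> k = (\<chi> i. \<lfloor>x $ i\<rfloor>)"
  by (auto simp: half_open_cube_def lattice_vec_def vec_eq_iff)

lemma periodic_ZnD: "periodic_Zn f \<Longrightarrow> f (x + lattice_vec k) = f x"
  by (simp add: periodic_Zn_def lattice_vec_def)

text \<open>Exactly one cell contains \<open>x\<close>, so the indicators form a partition of unity
  that can be inserted into any integrand without changing it.\<close>

lemma nn_integral_lattice_tiling:
  fixes x :: "real^'n"
  shows "(\<integral>\<^sup>+k. c * indicator half_open_cube (x - lattice_vec k) \<partial>count_space UNIV) = c"
proof -
  have *: "indicator half_open_cube (x - lattice_vec k) = (indicator {(\<chi> i. \<lfloor>x $ i\<rfloor>)} k :: ennreal)" for k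
    by (auto simp: half_open_cube_translate_iff split: split_indicator)
  show ?thesis unfolding * by simp
qed

text \<open>The lattice is symmetric under negation. This mirrored form is what remains after the
  substitution in the translation lemma below.\<close>

lemma nn_integral_lattice_tiling_uminus:
  fixes x :: "real^'n"
  shows "(\<integral>\<^sup>+k. c * indicator half_open_cube (x + lattice_vec k) \<partial>count_space UNIV) = c"
proof -
  have "lattice_vec (- k) = - lattice_vec k" for k :: "int^'n"
    by (simp add: lattice_vec_def vec_eq_iff)
  then have "x + lattice_vec k \<in> half_open_cube \<longleftrightarrow> - k = (\<chi> i. \<lfloor>x $ i\<rfloor>)" for k
    using half_open_cube_translate_iff[of x "- k"] by simp
  then have "x + lattice_vec k \<in> half_open_cube \<longleftrightarrow> k = - (\<chi> i. \<lfloor>x $ i\<rfloor>)" for k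
    by (metis minus_equation_iff)
  then have *: "indicator half_open_cube (x + lattice_vec k) = (indicator {- (\<chi> i. \<lfloor>x $ i\<rfloor>)} k :: ennreal)" for k
    by (auto split: split_indicator)
  show ?thesis unfolding * by simp
qed

text \<open>The shifted cube is cut along the lattice cells and each piece is moved back by its
  lattice vector, which the periodic \<open>g\<close> does not notice. The pieces reassemble into
  the original cube.\<close>

lemma nn_integral_half_open_cube_translate:
  fixes g :: "real^'n \<Rightarrow> ennreal"
  assumes per: "periodic_Zn g" and [measurable]: "g \<in> borel_measurable borel"
  shows "(\<integral>\<^sup>+x. g (x + w) * indicator half_open_cube x \<partial>lborel) = (\<integral>\<^sup>+x. g x * indicator half_open_cube x \<partial>lborel)"
proof -
  let ?D = "half_open_cube :: (real^'n) set"
  have "(\<integral>\<^sup>+x. g (x + w) * indicator ?D x \<partial>lborel)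
      = (\<integral>\<^sup>+x. (\<integral>\<^sup>+k. (g (x + w) * indicator ?D x) * indicator ?D ((x + w) - lattice_vec k) \<partial>count_space UNIV) \<partial>lborel)"
    by (simp only: nn_integral_lattice_tiling)
  also have "\<dots> = (\<integral>\<^sup>+k. (\<integral>\<^sup>+x. (g (x + w) * indicator ?D x) * indicator ?D ((x + w) - lattice_vec k) \<partial>lborel) \<partial>count_space UNIV)"
    by (rule nn_integral_count_space_nn_integral) auto
  also have "\<dots> = (\<integral>\<^sup>+k. (\<integral>\<^sup>+y. (g y * indicator ?D y) * indicator ?D ((y - w) + lattice_vec k) \<partial>lborel) \<partial>count_space UNIV)"
  proof (rule nn_integral_cong)
    fix k
    \<comment> \<open>Substituting \<open>x = y + (lattice_vec k - w)\<close> swaps the roles of the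
      indicators: the lattice cell becomes \<open>?D\<close> at \<open>y\<close>, while the original
      cube becomes the factor that summation over \<open>k\<close> removes.\<close>
    have "(\<integral>\<^sup>+x. (g (x + w) * indicator ?D x) * indicator ?D ((x + w) - lattice_vec k) \<partial>lborel)
       = (\<integral>\<^sup>+y. (g (y + (lattice_vec k - w) + w) * indicator ?D (y + (lattice_vec k - w)))
              * indicator ?D ((y + (lattice_vec k - w) + w) - lattice_vec k) \<partial>lborel)"
      by (rule nn_integral_lborel_translate[symmetric]) measurable
    also have "\<dots> = (\<integral>\<^sup>+y. (g y * indicator ?D y) * indicator ?D ((y - w) + lattice_vec k) \<partial>lborel)"
      by (intro nn_integral_cong) (simp add: algebra_simps periodic_ZnD[OF per])
    finally show "(\<integral>\<^sup>+x. (g (x + w) * indicator ?D x) * indicator ?D ((x + w) - lattice_vec k) \<partial>lborel)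
      = (\<integral>\<^sup>+y. (g y * indicator ?D y) * indicator ?D ((y - w) + lattice_vec k) \<partial>lborel)" .
  qed
  also have "\<dots> = (\<integral>\<^sup>+y. (\<integral>\<^sup>+k. (g y * indicator ?D y) * indicator ?D ((y - w) + lattice_vec k) \<partial>count_space UNIV) \<partial>lborel)"
    by (rule nn_integral_count_space_nn_integral[symmetric]) auto
  also have "\<dots> = (\<integral>\<^sup>+y. g y * indicator ?D y \<partial>lborel)"
    by (simp only: nn_integral_lattice_tiling_uminus)
  finally show ?thesis .
qed

lemma One_cart [simp]: "(One :: real^'n) $ i = 1"
proof -
  have "(One :: real^'n) \<bullet> axis i 1 = 1"
    by (intro inner_sum_Basis) (simp add: axis_eq_axis)
  then show ?thesis by (simp add: inner_axis)
qed

lemma mem_torus_cube: "x \<in> torus_cube \<longleftrightarrow> (\<forall>i. 0 \<le> x $ i \<and> x $ i \<le> 1)"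
  by (simp add: torus_cube_def mem_box_cart del: sum_component)

lemma torus_cube_measurable [measurable]: "torus_cube \<in> sets borel"
  by (simp add: torus_cube_def)

lemma half_open_cube_subset: "half_open_cube \<subseteq> torus_cube"
  by (auto simp: half_open_cube_def mem_torus_cube floor_eq_iff less_imp_le)

lemma emeasure_torus_cube [simp]: "emeasure lborel (torus_cube :: (real^'n) set) = 1"
  by (simp add: torus_cube_def emeasure_lborel_cbox_eq inner_diff_left)

text \<open>The half-open cube lies between the open box and the closed cube, and these both have
  measure one.\<close>

lemma AE_half_open_cube:
  "AE x in lborel. (x::real^'n) \<in> torus_cube \<longleftrightarrow> x \<in> half_open_cube"
proof -
  have 1: "AE x in lborel. (x::real^'n) \<notin> torus_cube - box 0 One"
  proof (rule AE_I[where N="torus_cube - box 0 One"])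
    show "emeasure lborel (torus_cube - box 0 One :: (real^'n) set) = 0"
      by (subst emeasure_Diff)
        (auto simp: torus_cube_def emeasure_lborel_cbox_eq emeasure_lborel_box_eq inner_diff_left
           box_subset_cbox[THEN subsetD])
  qed (auto simp: torus_cube_def)
  have 2: "x \<in> half_open_cube" if "x \<in> box 0 One" for x :: "real^'n"
    using that by (auto simp: half_open_cube_def mem_box_cart floor_eq_iff less_imp_le simp del: sum_component)
  show ?thesis using 1 by eventually_elim (use 2 half_open_cube_subset in auto)
qed

text \<open>Invariance of Haar measure on the torus, carried over to the closed cube that represents
  it.\<close>

lemma nn_integral_torus_cube_translate:
  fixes g :: "real^'n \<Rightarrow> ennreal"
  assumes per: "periodic_Zn g" and [measurable]: "g \<in> borel_measurable borel"
  shows "(\<integral>\<^sup>+x. g (x + w) * indicator torus_cube x \<partial>lborel) = (\<integral>\<^sup>+x. g x * indicator torus_cube x \<partial>lborel)"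
proof -
  have *: "(\<integral>\<^sup>+x. f x * indicator torus_cube x \<partial>lborel) = (\<integral>\<^sup>+x. f x * indicator half_open_cube x \<partial>lborel)"
    for f :: "real^'n \<Rightarrow> ennreal"
    by (rule nn_integral_cong_AE) (use AE_half_open_cube in eventually_elim, auto split: split_indicator)
  show ?thesis unfolding * by (rule nn_integral_half_open_cube_translate[OF assms])
qed

text \<open>Used to extend bounds on periodic functions from the cube to the whole space.\<close>

lemma lattice_translate_of_cube:
  fixes x :: "real^'n"
  obtains y k where "y \<in> torus_cube" "x = y + lattice_vec k"
proof
  let ?k = "(\<chi> i. \<lfloor>x $ i\<rfloor>) :: int^'n"
  show "x - lattice_vec ?k \<in> torus_cube"
    using half_open_cube_subset half_open_cube_translate_iff by blast
qed simp

section \<open>Gaussian integrals and bounds for continuous periodic functions\<close>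

lemma nn_integral_gaussian_finite:
  assumes "a > 0"
  shows "(\<integral>\<^sup>+v. ennreal (exp (- a * (norm (v::'a::euclidean_space))\<^sup>2)) \<partial>lborel) < \<infinity>"
proof -
  have 1: "(\<integral>\<^sup>+t. ennreal (exp (- a * t\<^sup>2)) \<partial>(lborel :: real measure)) < \<infinity>"
  proof -
    \<comment> \<open>The standard deviation for which the centred normal density is proportional to
      \<open>exp (- a * t\<^sup>2)\<close>.\<close>
    define s where "s = sqrt (1 / (2 * a))"
    have s: "s > 0" "s\<^sup>2 = 1 / (2 * a)" using assms by (auto simp: s_def)
    have eq: "exp (- a * t\<^sup>2) = sqrt (2 * pi * s\<^sup>2) * normal_density 0 s t" for t
      using assms s by (simp add: normal_density_def)
    have "integrable lborel (\<lambda>t. exp (- a * t\<^sup>2))"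
      unfolding eq using s(1) by (intro integrable_mult_right) simp
    then show ?thesis by (simp add: integrable_iff_bounded)
  qed
  \<comment> \<open>The squared norm splits over the basis, so the integral factors into
    one-dimensional Gaussians.\<close>
  have "(\<integral>\<^sup>+v. ennreal (exp (- a * (norm (v::'a))\<^sup>2)) \<partial>lborel)
     = (\<integral>\<^sup>+v. (\<Prod>b\<in>Basis. ennreal (exp (- a * (v \<bullet> b)\<^sup>2))) \<partial>(lborel :: 'a measure))"
  proof (rule nn_integral_cong)
    fix v :: 'a
    have "(norm v)\<^sup>2 = (\<Sum>b\<in>Basis. (v \<bullet> b)\<^sup>2)"
      by (simp add: norm_eq_sqrt_inner euclidean_inner[of v v] power2_eq_square sum_nonneg)
    then have "exp (- a * (norm v)\<^sup>2) = exp (\<Sum>b\<in>Basis. - a * (v \<bullet> b)\<^sup>2)"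
      by (simp only: sum_distrib_left)
    also have "\<dots> = (\<Prod>b\<in>Basis. exp (- a * (v \<bullet> b)\<^sup>2))"
      by (rule exp_sum) simp
    finally show "ennreal (exp (- a * (norm v)\<^sup>2)) = (\<Prod>b\<in>Basis. ennreal (exp (- a * (v \<bullet> b)\<^sup>2)))"
      by (simp only: prod_ennreal exp_ge_zero)
  qed
  also have "\<dots> = (\<Prod>b\<in>(Basis::'a set). (\<integral>\<^sup>+t. ennreal (exp (- a * t\<^sup>2)) \<partial>lborel))"
    by (rule nn_integral_lborel_prod) auto
  also have "\<dots> < \<infinity>" using 1 by (simp add: power_less_top_ennreal)
  finally show ?thesis .
qed

lemma continuous_periodic_bounded:
  fixes f :: "real^'n \<Rightarrow> real"
  assumes "continuous_on UNIV f" "periodic_Zn f"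
  obtains B where "\<And>x. \<bar>f x\<bar> \<le> B"
proof -
  have "compact (f ` torus_cube)"
    by (rule compact_continuous_image) (use assms continuous_on_subset in \<open>auto simp: torus_cube_def\<close>)
  then obtain B where B: "\<And>x. x \<in> torus_cube \<Longrightarrow> \<bar>f x\<bar> \<le> B"
    by (fastforce dest!: compact_imp_bounded simp: bounded_iff)
  have *: "\<bar>f x\<bar> \<le> B" for x
    by (rule lattice_translate_of_cube[of x]) (use B assms(2) in \<open>simp add: periodic_ZnD\<close>)
  then show ?thesis by (rule that)
qed

section \<open>Integrable and bounded functions on the torus\<close>

definition torus_L1 :: "(real^'n \<Rightarrow> complex) \<Rightarrow> bool" where
  "torus_L1 f \<longleftrightarrow> periodic_Zn f \<and> f \<in> borel_measurable borel \<and> set_integrable lborel torus_cube f"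

text \<open>The bound is required at every point rather than almost everywhere, since the
  fixed-point and eigenvalue equations for bounded functions are treated pointwise.\<close>

definition torus_bounded :: "(real^'n \<Rightarrow> complex) \<Rightarrow> bool" where
  "torus_bounded f \<longleftrightarrow> periodic_Zn f \<and> f \<in> borel_measurable borel \<and> (\<exists>B. \<forall>x. cmod (f x) \<le> B)"

lemma torus_bounded_imp_L1:
  fixes f :: "real^'n \<Rightarrow> complex"
  assumes "torus_bounded f"
  shows "torus_L1 f"
proof -
  obtain B where B: "\<And>x. cmod (f x) \<le> B" and [measurable]: "f \<in> borel_measurable borel"
    using assms by (auto simp: torus_bounded_def)
  have "set_integrable lborel torus_cube f"
    unfolding set_integrable_def
    by (rule integrableI_bounded_set[where A=torus_cube and B=B]) (use B in auto)
  with assms show ?thesis by (simp add: torus_L1_def torus_bounded_def)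
qed

lemma torus_bounded_const: "torus_bounded (\<lambda>_. c)"
  by (auto simp: torus_bounded_def periodic_Zn_def)

lemma torus_bounded_add:
  assumes "torus_bounded f" "torus_bounded g" shows "torus_bounded (\<lambda>x. f x + g x)"
proof -
  obtain A B where "\<And>x. cmod (f x) \<le> A" "\<And>x. cmod (g x) \<le> B"
    using assms by (auto simp: torus_bounded_def)
  then have "cmod (f x + g x) \<le> A + B" for x
    by (meson norm_triangle_mono)
  with assms show ?thesis by (auto simp: torus_bounded_def periodic_Zn_def)
qed

lemma torus_bounded_mult_left:
  assumes "torus_bounded f" shows "torus_bounded (\<lambda>x. c * f x)"
proof -
  obtain A where "\<And>x. cmod (f x) \<le> A"
    using assms by (auto simp: torus_bounded_def)
  then have "cmod (c * f x) \<le> cmod c * A" for x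
    by (simp add: norm_mult mult_left_mono)
  with assms show ?thesis by (auto simp: torus_bounded_def periodic_Zn_def)
qed

lemma torus_L1_add: "torus_L1 f \<Longrightarrow> torus_L1 g \<Longrightarrow> torus_L1 (\<lambda>x. f x + g x)"
  by (auto simp: torus_L1_def periodic_Zn_def)

lemma torus_L1_mult_left: "torus_L1 f \<Longrightarrow> torus_L1 (\<lambda>x. c * f x)"
  by (auto simp: torus_L1_def periodic_Zn_def)

lemma nn_integral_torus_L1_finite:
  assumes "torus_L1 f"
  shows "(\<integral>\<^sup>+x. ennreal (cmod (f x)) * indicator torus_cube x \<partial>lborel) < \<infinity>"
proof -
  have "(\<integral>\<^sup>+x. ennreal (cmod (f x)) * indicator torus_cube x \<partial>lborel)
     = (\<integral>\<^sup>+x. ennreal (cmod (indicator torus_cube x *\<^sub>R f x)) \<partial>lborel)"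
    by (intro nn_integral_cong) (auto split: split_indicator)
  with assms show ?thesis
    by (auto simp: torus_L1_def set_integrable_def integrable_iff_bounded)
qed

text \<open>The mean is taken for Lebesgue measure and not for the weight \<open>\<theta>\<close>:
  it is the functional singled out by a constant lower bound on the kernel.\<close>

definition cube_mean :: "(real^'n \<Rightarrow> complex) \<Rightarrow> complex" where
  "cube_mean f = (LINT x:torus_cube|lborel. f x)"

lemma cube_mean_const: "cube_mean (\<lambda>_::real^'n. c) = c"
  by (simp add: cube_mean_def set_lebesgue_integral_def measure_def)

lemma cube_mean_add: "torus_L1 f \<Longrightarrow> torus_L1 g \<Longrightarrow> cube_mean (\<lambda>x. f x + g x) = cube_mean f + cube_mean g"
  by (simp add: cube_mean_def torus_L1_def set_integral_add)

lemma cube_mean_mult_left: "cube_mean (\<lambda>x. c * f x) = c * cube_mean f"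
  by (simp add: cube_mean_def)

section \<open>Kernels with a Gaussian bound and a Doeblin minorization\<close>

locale doeblin_kernel =
  fixes \<kappa> :: "real^'n \<Rightarrow> real^'n \<Rightarrow> real" and h C a c :: real
  assumes h_pos: "h > 0" and a_pos: "a > 0" and c_pos: "c > 0"
    and kernel_measurable: "(\<lambda>(x, v). \<kappa> x v) \<in> borel_measurable (lborel \<Otimes>\<^sub>M lborel)"
    and kernel_nonneg: "\<kappa> x v \<ge> 0"
    and kernel_le: "\<kappa> x v \<le> C * exp (- a * (norm v)\<^sup>2)"
    and kernel_periodic: "periodic_Zn (\<lambda>x. \<kappa> x v)"
    and kernel_integral: "(\<integral>v. \<kappa> x v \<partial>lborel) = 1"
    and kernel_minorization:
      "x \<in> torus_cube \<Longrightarrow> x + h *\<^sub>R v \<in> torus_cube \<Longrightarrow> c * h ^ CARD('n) \<le> \<kappa> x v"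
begin

lemma kernel_borel [measurable]: "(\<lambda>(x, v). \<kappa> x v) \<in> borel_measurable (borel \<Otimes>\<^sub>M borel)"
  using kernel_measurable by (simp cong: measurable_cong_sets)

definition T :: "(real^'n \<Rightarrow> complex) \<Rightarrow> real^'n \<Rightarrow> complex" where
  "T f x = (\<integral>v. complex_of_real (\<kappa> x v) * f (x + h *\<^sub>R v) \<partial>lborel)"

lemma C_nonneg: "C \<ge> 0"
  using order_trans[OF kernel_nonneg kernel_le] by (metis exp_gt_zero zero_le_mult_iff not_less)

text \<open>Replacing the Gaussian weight at \<open>v\<close> by a wider one at \<open>v - t / h\<close> and averaging over
  shifts by the cube turns the integral over \<open>\<real>\<^sup>n\<close> into one over the torus.\<close>

lemma nn_integral_kernel_le:
  obtains K where "K \<ge> 0" and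
    "\<And>G x. periodic_Zn G \<Longrightarrow> G \<in> borel_measurable borel \<Longrightarrow>
      (\<integral>\<^sup>+v. ennreal (\<kappa> x v) * G (x + h *\<^sub>R v) \<partial>lborel)
        \<le> ennreal K * (\<integral>\<^sup>+y. G y * indicator torus_cube y \<partial>lborel)"
proof -
  \<comment> \<open>Halving the rate pays for the shift by \<open>t /\<^sub>R h\<close>, because
    \<open>|v - s|^2\<close> is at most \<open>2 |v|^2 + 2 |s|^2\<close>. The shift term, bounded
    through \<open>M / h\<close>, goes into the constant \<open>E\<close>.\<close>
  define b where "b = a / 2"
  have b: "b > 0" using a_pos by (simp add: b_def)
  obtain M where M: "M \<ge> 0" "\<And>t::real^'n. t \<in> torus_cube \<Longrightarrow> norm t \<le> M"
    using bounded_cbox[of "0::real^'n" One] unfolding torus_cube_def bounded_pos by (meson less_imp_le)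
  define E where "E = C * exp (a * (M / h)\<^sup>2)"
  have E: "E \<ge> 0" using C_nonneg by (simp add: E_def)
  define Z where "Z = (\<integral>\<^sup>+v. ennreal (exp (- b * (norm (v::real^'n))\<^sup>2)) \<partial>lborel)"
  have Z: "Z < \<infinity>" unfolding Z_def by (rule nn_integral_gaussian_finite[OF b])
  have gauss: "\<kappa> x v \<le> E * exp (- b * (norm (v - t /\<^sub>R h))\<^sup>2)" if t: "t \<in> torus_cube" for x v t
  proof -
    have "norm (t /\<^sub>R h) \<le> M / h" using M(2)[OF t] h_pos by (simp add: field_simps)
    then have 1: "(norm (t /\<^sub>R h))\<^sup>2 \<le> (M / h)\<^sup>2" by (simp add: power_mono)
    have "(norm (v - t /\<^sub>R h))\<^sup>2 \<le> (norm v + norm (t /\<^sub>R h))\<^sup>2"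
      by (intro power_mono norm_triangle_ineq4) simp
    also have "\<dots> \<le> 2 * (norm v)\<^sup>2 + 2 * (norm (t /\<^sub>R h))\<^sup>2"
      using sum_squares_bound[of "norm v" "norm (t /\<^sub>R h)"] by (simp add: power2_sum)
    finally have "(norm (v - t /\<^sub>R h))\<^sup>2 \<le> 2 * (norm v)\<^sup>2 + 2 * (M / h)\<^sup>2" using 1 by linarith
    then have "b * (norm (v - t /\<^sub>R h))\<^sup>2 \<le> b * (2 * (norm v)\<^sup>2 + 2 * (M / h)\<^sup>2)"
      using b by (intro mult_left_mono) auto
    then have "- a * (norm v)\<^sup>2 \<le> a * (M / h)\<^sup>2 + - b * (norm (v - t /\<^sub>R h))\<^sup>2"
      by (simp add: b_def algebra_simps)
    then have "exp (- a * (norm v)\<^sup>2) \<le> exp (a * (M / h)\<^sup>2) * exp (- b * (norm (v - t /\<^sub>R h))\<^sup>2)"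
      by (simp flip: exp_add)
    then have "C * exp (- a * (norm v)\<^sup>2) \<le> E * exp (- b * (norm (v - t /\<^sub>R h))\<^sup>2)"
      using C_nonneg by (simp add: E_def mult.assoc mult_left_mono)
    with kernel_le show ?thesis by (rule order_trans)
  qed
  have main: "(\<integral>\<^sup>+v. ennreal (\<kappa> x v) * G (x + h *\<^sub>R v) \<partial>lborel)
        \<le> (ennreal E * Z) * (\<integral>\<^sup>+y. G y * indicator torus_cube y \<partial>lborel)"
    if per: "periodic_Zn G" and [measurable]: "G \<in> borel_measurable borel" for G :: "real^'n \<Rightarrow> ennreal" and x
  proof -
    let ?I = "\<integral>\<^sup>+v. ennreal (\<kappa> x v) * G (x + h *\<^sub>R v) \<partial>lborel"
    let ?g = "\<lambda>v::real^'n. ennreal (exp (- b * (norm v)\<^sup>2))"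
    have step: "?I \<le> ennreal E * (\<integral>\<^sup>+u. ?g u * G (t + (x + h *\<^sub>R u)) \<partial>lborel)" if t: "t \<in> torus_cube" for t
    proof -
      have "?I \<le> (\<integral>\<^sup>+v. ennreal E * (?g (v - t /\<^sub>R h) * G (t + (x + h *\<^sub>R (v - t /\<^sub>R h)))) \<partial>lborel)"
      proof (rule nn_integral_mono)
        fix v :: "real^'n"
        have "ennreal (\<kappa> x v) \<le> ennreal E * ?g (v - t /\<^sub>R h)"
          using ennreal_leI[OF gauss[OF t, of x v]] E by (simp add: ennreal_mult)
        moreover have "t + (x + h *\<^sub>R (v - t /\<^sub>R h)) = x + h *\<^sub>R v"
          using h_pos by (simp add: algebra_simps)
        ultimately show "ennreal (\<kappa> x v) * G (x + h *\<^sub>R v)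
            \<le> ennreal E * (?g (v - t /\<^sub>R h) * G (t + (x + h *\<^sub>R (v - t /\<^sub>R h))))"
          by (simp only: mult.assoc[symmetric] mult_right_mono[OF _ zero_le])
      qed
      also have "\<dots> = (\<integral>\<^sup>+u. ennreal E * (?g u * G (t + (x + h *\<^sub>R u))) \<partial>lborel)"
        using nn_integral_lborel_translate[of "\<lambda>u. ennreal E * (?g u * G (t + (x + h *\<^sub>R u)))" "- (t /\<^sub>R h)"]
        by simp
      also have "\<dots> = ennreal E * (\<integral>\<^sup>+u. ?g u * G (t + (x + h *\<^sub>R u)) \<partial>lborel)"
        by (rule nn_integral_cmult) measurable
      finally show ?thesis .
    qed
    \<comment> \<open>The cube has measure one, so \<open>?I\<close> equals its own average over the
      shifts \<open>t\<close>.\<close>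
    have "?I = (\<integral>\<^sup>+t. ?I * indicator torus_cube (t::real^'n) \<partial>lborel)"
      by (subst nn_integral_cmult_indicator) auto
    also have "\<dots> \<le> (\<integral>\<^sup>+t. (ennreal E * (\<integral>\<^sup>+u. ?g u * G (t + (x + h *\<^sub>R u)) \<partial>lborel)) * indicator torus_cube t \<partial>lborel)"
      by (intro nn_integral_mono) (use step in \<open>auto split: split_indicator\<close>)
    also have "\<dots> = (\<integral>\<^sup>+t. (\<integral>\<^sup>+u. ennreal E * ?g u * (G (t + (x + h *\<^sub>R u)) * indicator torus_cube t) \<partial>lborel) \<partial>lborel)"
      by (intro nn_integral_cong) (simp add: nn_integral_cmult[symmetric] nn_integral_multc[symmetric] mult_ac)
    \<comment> \<open>With \<open>t\<close> as the inner variable, translation invariance removes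
      \<open>x + h *\<^sub>R u\<close> from the argument of \<open>G\<close>, and only the Gaussian
      mass is left to integrate over \<open>u\<close>.\<close>
    also have "\<dots> = (\<integral>\<^sup>+u. (\<integral>\<^sup>+t. ennreal E * ?g u * (G (t + (x + h *\<^sub>R u)) * indicator torus_cube t) \<partial>lborel) \<partial>lborel)"
      by (rule lborel_pair.Fubini') measurable
    also have "\<dots> = (\<integral>\<^sup>+u. ennreal E * ?g u * (\<integral>\<^sup>+y. G y * indicator torus_cube y \<partial>lborel) \<partial>lborel)"
      by (intro nn_integral_cong) (subst nn_integral_cmult, measurable, simp only: nn_integral_torus_cube_translate[OF that])
    also have "\<dots> = (ennreal E * Z) * (\<integral>\<^sup>+y. G y * indicator torus_cube y \<partial>lborel)"
      by (simp add: nn_integral_multc nn_integral_cmult Z_def)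
    finally show ?thesis .
  qed
  have "ennreal E * Z = ennreal (E * enn2real Z)"
    using Z E by (simp add: ennreal_mult)
  with main show ?thesis
    using that[of "E * enn2real Z"] E by simp
qed

end

text \<open>Rewrites an integral over positions as one over velocities, so that the mean over the
  torus can be compared with the kernel.\<close>

lemma integral_lborel_affine:
  fixes f :: "'a::euclidean_space \<Rightarrow> 'b::{banach, second_countable_topology}"
  assumes [measurable]: "f \<in> borel_measurable borel" and "h > 0"
  shows "(\<integral>y. f y \<partial>lborel) = h ^ DIM('a) *\<^sub>R (\<integral>v. f (x + h *\<^sub>R v) \<partial>lborel)"
proof -
  have "(\<integral>y. f y \<partial>lborel) = (\<integral>y. f y \<partial>density (distr lborel borel (\<lambda>v. x + h *\<^sub>R v)) (\<lambda>_. ennreal (\<bar>h\<bar> ^ DIM('a))))"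
    by (subst lborel_affine[of h x]) (use assms(2) in \<open>auto simp: ennreal_power\<close>)
  also have "\<dots> = (\<integral>y. \<bar>h\<bar> ^ DIM('a) *\<^sub>R f y \<partial>distr lborel borel (\<lambda>v. x + h *\<^sub>R v))"
    by (rule integral_density) auto
  also have "\<dots> = (\<integral>v. \<bar>h\<bar> ^ DIM('a) *\<^sub>R f (x + h *\<^sub>R v) \<partial>lborel)"
    by (rule integral_distr) auto
  finally show ?thesis using assms(2) by simp
qed

section \<open>The kernel operator on integrable functions\<close>

context doeblin_kernel
begin

lemma torus_L1_borel: "torus_L1 f \<Longrightarrow> f \<in> borel_measurable borel"
  by (simp add: torus_L1_def)

text \<open>A function that is not integrable has integral \<open>0\<close> by convention, so the
  value \<open>1\<close> forces integrability.\<close>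

lemma kernel_integrable: "integrable lborel (\<lambda>v. \<kappa> x v)"
  using kernel_integral[of x] not_integrable_integral_eq by fastforce

lemma nn_integral_T_le:
  obtains K where "K \<ge> 0" and
    "\<And>f x. torus_L1 f \<Longrightarrow> (\<integral>\<^sup>+v. ennreal (cmod (complex_of_real (\<kappa> x v) * f (x + h *\<^sub>R v))) \<partial>lborel)
        \<le> ennreal K * (\<integral>\<^sup>+y. ennreal (cmod (f y)) * indicator torus_cube y \<partial>lborel)"
proof -
  obtain K where K: "K \<ge> 0" and
    *: "\<And>G x. periodic_Zn G \<Longrightarrow> G \<in> borel_measurable borel \<Longrightarrow>
      (\<integral>\<^sup>+v. ennreal (\<kappa> x v) * G (x + h *\<^sub>R v) \<partial>lborel)
        \<le> ennreal K * (\<integral>\<^sup>+y. G y * indicator torus_cube y \<partial>lborel)"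
    by (rule nn_integral_kernel_le) (rule that)
  have "(\<integral>\<^sup>+v. ennreal (cmod (complex_of_real (\<kappa> x v) * f (x + h *\<^sub>R v))) \<partial>lborel)
        \<le> ennreal K * (\<integral>\<^sup>+y. ennreal (cmod (f y)) * indicator torus_cube y \<partial>lborel)"
    if "torus_L1 f" for f x
  proof -
    have "periodic_Zn (\<lambda>y. ennreal (cmod (f y)))" "f \<in> borel_measurable borel"
      using that by (auto simp: torus_L1_def periodic_Zn_def)
    then show ?thesis
      using *[of "\<lambda>y. ennreal (cmod (f y))" x] by (simp add: norm_mult kernel_nonneg ennreal_mult)
  qed
  with K that show ?thesis by blast
qed

lemma T_integrand_measurable:
  assumes "torus_L1 f"
  shows "(\<lambda>v. complex_of_real (\<kappa> x v) * f (x + h *\<^sub>R v)) \<in> borel_measurable lborel"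
proof -
  note [measurable] = torus_L1_borel[OF assms]
  show ?thesis by measurable
qed

lemma T_integrable:
  assumes "torus_L1 f"
  shows "integrable lborel (\<lambda>v. complex_of_real (\<kappa> x v) * f (x + h *\<^sub>R v))"
proof (rule integrableI_bounded)
  show "(\<integral>\<^sup>+v. ennreal (cmod (complex_of_real (\<kappa> x v) * f (x + h *\<^sub>R v))) \<partial>lborel) < \<infinity>"
  proof (rule nn_integral_T_le)
    fix K :: real
    assume "\<And>f x. torus_L1 f \<Longrightarrow> (\<integral>\<^sup>+v. ennreal (cmod (complex_of_real (\<kappa> x v) * f (x + h *\<^sub>R v))) \<partial>lborel)
        \<le> ennreal K * (\<integral>\<^sup>+y. ennreal (cmod (f y)) * indicator torus_cube y \<partial>lborel)"
    from this[OF assms] show ?thesis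
      by (rule order_le_less_trans)
         (use nn_integral_torus_L1_finite[OF assms] in \<open>simp add: ennreal_mult_less_top\<close>)
  qed
qed (rule T_integrand_measurable[OF assms])

text \<open>A single constant serves all \<open>f\<close> and all \<open>x\<close>. This smoothing
  from integrable to bounded functions is what reduces the weighted space to the sup norm.\<close>

lemma T_L1_bound:
  obtains K where "K \<ge> 0" and
    "\<And>f x. torus_L1 f \<Longrightarrow> ennreal (cmod (T f x))
        \<le> ennreal K * (\<integral>\<^sup>+y. ennreal (cmod (f y)) * indicator torus_cube y \<partial>lborel)"
proof (rule nn_integral_T_le)
  fix K :: real
  assume K: "K \<ge> 0" "\<And>f x. torus_L1 f \<Longrightarrow> (\<integral>\<^sup>+v. ennreal (cmod (complex_of_real (\<kappa> x v) * f (x + h *\<^sub>R v))) \<partial>lborel)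
        \<le> ennreal K * (\<integral>\<^sup>+y. ennreal (cmod (f y)) * indicator torus_cube y \<partial>lborel)"
  show ?thesis
  proof (rule that[OF K(1)])
    fix f :: "real^'n \<Rightarrow> complex" and x assume "torus_L1 f"
    then show "ennreal (cmod (T f x)) \<le> ennreal K * (\<integral>\<^sup>+y. ennreal (cmod (f y)) * indicator torus_cube y \<partial>lborel)"
      unfolding T_def using integral_norm_bound_ennreal[OF T_integrable] K(2) order_trans by blast
  qed
qed

lemma T_bounded:
  assumes "torus_L1 f"
  shows "torus_bounded (T f)"
proof -
  have "periodic_Zn (T f)"
    unfolding periodic_Zn_def
  proof (intro allI impI)
    fix x k :: "real^'n" assume k: "\<forall>i. k $ i \<in> \<int>"
    have "\<kappa> (x + k) v = \<kappa> x v" for v using kernel_periodic k by (simp add: periodic_Zn_def)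
    moreover have "f (x + k + h *\<^sub>R v) = f (x + h *\<^sub>R v)" for v
    proof -
      have "x + k + h *\<^sub>R v = (x + h *\<^sub>R v) + k" by simp
      moreover have "f (y + k) = f y" for y using assms k by (simp add: torus_L1_def periodic_Zn_def)
      ultimately show ?thesis by (simp only:)
    qed
    ultimately show "T f (x + k) = T f x" by (simp add: T_def)
  qed
  moreover have "T f \<in> borel_measurable borel"
  proof -
    note [measurable] = torus_L1_borel[OF assms]
    show ?thesis unfolding T_def by measurable
  qed
  moreover have "\<exists>B. \<forall>x. cmod (T f x) \<le> B"
  proof (rule T_L1_bound)
    fix K assume K: "K \<ge> 0" "\<And>f x. torus_L1 f \<Longrightarrow> ennreal (cmod (T f x))
        \<le> ennreal K * (\<integral>\<^sup>+y. ennreal (cmod (f y)) * indicator torus_cube y \<partial>lborel)"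
    let ?N = "ennreal K * (\<integral>\<^sup>+y. ennreal (cmod (f y)) * indicator torus_cube y \<partial>lborel)"
    have "?N < \<infinity>" using nn_integral_torus_L1_finite[OF assms] by (simp add: ennreal_mult_less_top)
    then have "cmod (T f x) \<le> enn2real ?N" for x
      using enn2real_mono[OF K(2)[OF assms, of x]] by simp
    then show ?thesis by blast
  qed
  ultimately show ?thesis by (simp add: torus_bounded_def)
qed

lemma T_add: "torus_L1 f \<Longrightarrow> torus_L1 g \<Longrightarrow> T (\<lambda>x. f x + g x) x = T f x + T g x"
  by (simp add: T_def distrib_left T_integrable)

lemma T_mult_left: "T (\<lambda>x. k * f x) x = k * T f x"
  by (simp add: T_def mult.left_commute[of _ k])

lemma T_const: "T (\<lambda>_. k) x = k"
  by (simp add: T_def kernel_integral)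

text \<open>The smoothing bound makes the image of the difference vanish at every point, so an
  equation that holds almost everywhere becomes exact after one application of
  \<open>T\<close>.\<close>

lemma T_ae_cong:
  assumes f: "torus_L1 f" and g: "torus_L1 g" and eq: "ae_eq f g"
  shows "T f = T g"
proof
  fix x
  let ?d = "\<lambda>x. f x + (- 1) * g x"
  have d: "torus_L1 ?d" by (intro torus_L1_add torus_L1_mult_left f g)
  have "AE y in lborel. ennreal (cmod (?d y)) * indicator torus_cube y = 0"
    using eq[unfolded ae_eq_def] by eventually_elim (auto split: split_indicator)
  then have 0: "(\<integral>\<^sup>+y. ennreal (cmod (?d y)) * indicator torus_cube y \<partial>lborel) = 0"
    by (subst nn_integral_0_iff_AE) (use torus_L1_borel[OF d] in auto)
  have "T ?d x = 0"
  proof (rule T_L1_bound)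
    fix K :: real
    assume "\<And>f x. torus_L1 f \<Longrightarrow> ennreal (cmod (T f x))
        \<le> ennreal K * (\<integral>\<^sup>+y. ennreal (cmod (f y)) * indicator torus_cube y \<partial>lborel)"
    from this[OF d, of x] show "T ?d x = 0" by (simp only: 0 mult_zero_right) simp
  qed
  moreover have "T ?d x = T f x + (- 1) * T g x"
    using T_add[OF f torus_L1_mult_left[OF g, of "- 1"]] T_mult_left by metis
  ultimately show "T f x = T g x" by simp
qed

section \<open>The contraction left after removing the minorizing part\<close>

definition R :: "(real^'n \<Rightarrow> complex) \<Rightarrow> real^'n \<Rightarrow> complex" where
  "R f x = T f x - complex_of_real c * cube_mean f"

lemma R_bounded: "torus_L1 f \<Longrightarrow> torus_bounded (R f)"
  using torus_bounded_add[OF T_bounded torus_bounded_const[of "- (complex_of_real c * cube_mean f)"], of f]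
  by (simp add: R_def[abs_def])

lemma R_add: "torus_L1 f \<Longrightarrow> torus_L1 g \<Longrightarrow> R (\<lambda>x. f x + g x) x = R f x + R g x"
  by (simp add: R_def T_add cube_mean_add algebra_simps)

lemma R_mult_left: "R (\<lambda>x. k * f x) x = k * R f x"
  by (simp add: R_def T_mult_left cube_mean_mult_left algebra_simps)

lemma R_const: "R (\<lambda>_. k) x = (1 - complex_of_real c) * k"
  by (simp add: R_def T_const cube_mean_const algebra_simps)

text \<open>By the minorization, \<open>R\<close> is integration against a nonnegative kernel of mass \<open>1 - c\<close>.\<close>

lemma R_contraction_cube:
  assumes f: "torus_bounded f" and B: "\<And>x. cmod (f x) \<le> B" and x: "x \<in> torus_cube"
  shows "cmod (R f x) \<le> (1 - c) * B"
proof -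
  note [measurable] = torus_L1_borel[OF torus_bounded_imp_L1[OF f]]
  \<comment> \<open>The factor \<open>h ^ CARD('n)\<close> is the Jacobian of the map from
    \<open>v\<close> to \<open>x + h *\<^sub>R v\<close>. With it, integrating against
    \<open>\<rho>\<close> gives exactly \<open>c\<close> times the mean over the torus, and the
    minorization says that \<open>\<rho>\<close> lies below the kernel.\<close>
  define \<rho> where "\<rho> v = c * h ^ CARD('n) * indicator torus_cube (x + h *\<^sub>R v)" for v :: "real^'n"
  have [measurable]: "\<rho> \<in> borel_measurable borel" unfolding \<rho>_def by measurable
  have \<rho>: "0 \<le> \<rho> v" "\<rho> v \<le> \<kappa> x v" for v
    using kernel_minorization[OF x, of v] kernel_nonneg[of x v] c_pos h_pos
    by (auto simp: \<rho>_def split: split_indicator)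
  have int_\<rho>: "integrable lborel \<rho>"
    by (rule Bochner_Integration.integrable_bound[OF kernel_integrable[of x]]) (use \<rho> in \<open>auto intro!: AE_I2 intro: order_trans[OF _ abs_ge_self]\<close>)
  have int_\<rho>f: "integrable lborel (\<lambda>v. complex_of_real (\<rho> v) * f (x + h *\<^sub>R v))"
    by (rule Bochner_Integration.integrable_bound[OF T_integrable[OF torus_bounded_imp_L1[OF f], of x]])
       (use \<rho> kernel_nonneg in \<open>auto simp: norm_mult mult_right_mono intro!: AE_I2\<close>)
  have mean: "complex_of_real c * cube_mean g = (\<integral>v. complex_of_real (\<rho> v) * g (x + h *\<^sub>R v) \<partial>lborel)"
    if [measurable]: "g \<in> borel_measurable borel" for g :: "real^'n \<Rightarrow> complex"
  proof -
    have "cube_mean g = h ^ CARD('n) *\<^sub>R (\<integral>v. indicator torus_cube (x + h *\<^sub>R v) *\<^sub>R g (x + h *\<^sub>R v) \<partial>lborel)"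
      unfolding cube_mean_def set_lebesgue_integral_def
      by (subst integral_lborel_affine[OF _ h_pos, of _ x]) auto
    then have "complex_of_real c * cube_mean g
        = (\<integral>v. complex_of_real (c * h ^ CARD('n)) * (indicator torus_cube (x + h *\<^sub>R v) *\<^sub>R g (x + h *\<^sub>R v)) \<partial>lborel)"
      by (simp add: scaleR_conv_of_real mult.assoc)
    then show ?thesis by (simp add: \<rho>_def scaleR_conv_of_real mult.assoc)
  qed
  have "complex_of_real (\<integral>v. \<rho> v \<partial>lborel) = complex_of_real c"
    using mean[of "\<lambda>_. 1"] by (simp add: cube_mean_const)
  then have mass: "(\<integral>v. \<rho> v \<partial>lborel) = c" by (simp only: of_real_eq_iff)
  have "R f x = (\<integral>v. complex_of_real (\<kappa> x v) * f (x + h *\<^sub>R v) - complex_of_real (\<rho> v) * f (x + h *\<^sub>R v) \<partial>lborel)"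
    using T_integrable[OF torus_bounded_imp_L1[OF f], of x] int_\<rho>f by (simp add: R_def T_def mean)
  also have "\<dots> = (\<integral>v. complex_of_real (\<kappa> x v - \<rho> v) * f (x + h *\<^sub>R v) \<partial>lborel)"
    by (simp add: left_diff_distrib)
  finally have "cmod (R f x) \<le> (\<integral>v. cmod (complex_of_real (\<kappa> x v - \<rho> v) * f (x + h *\<^sub>R v)) \<partial>lborel)"
    by simp
  also have "\<dots> \<le> (\<integral>v. (\<kappa> x v - \<rho> v) * B \<partial>lborel)"
  proof (rule integral_mono')
    show "integrable lborel (\<lambda>v. (\<kappa> x v - \<rho> v) * B)"
      using kernel_integrable int_\<rho> by auto
  qed (use \<rho> B in \<open>auto simp: norm_mult simp flip: of_real_diff intro!: mult_left_mono mult_nonneg_nonneg intro: order_trans[OF norm_ge_zero]\<close>)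
  also have "\<dots> = (1 - c) * B"
    using kernel_integrable int_\<rho> by (simp add: kernel_integral mass)
  finally show ?thesis .
qed

lemma R_contraction:
  assumes f: "torus_bounded f" and B: "\<And>x. cmod (f x) \<le> B"
  shows "cmod (R f x) \<le> (1 - c) * B"
proof (rule lattice_translate_of_cube[of x])
  fix y k assume "y \<in> torus_cube" "x = y + lattice_vec k"
  then show ?thesis
    using R_contraction_cube[OF f B] R_bounded[OF torus_bounded_imp_L1[OF f]]
    by (simp add: torus_bounded_def periodic_ZnD)
qed

text \<open>The contraction bound for the constant function \<open>1\<close> cannot be
  negative.\<close>

lemma c_le_1: "c \<le> 1"
  using R_contraction[OF torus_bounded_const, of 1 1 0] order_trans[OF norm_ge_zero, of _ "1 - c"] by fastforce

section \<open>Neumann series for the contraction\<close>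

lemma R_fixed_point:
  assumes g: "torus_bounded g" and z: "cmod z > 1 - c"
  obtains u where "torus_bounded u" "\<And>x. u x = g x + R u x / z"
proof -
  define S where "S f x = R f x / z" for f :: "real^'n \<Rightarrow> complex" and x
  \<comment> \<open>The contraction ratio of \<open>S\<close> in the sup norm. It is below one
    exactly because \<open>z\<close> lies outside the disc of radius \<open>1 - c\<close>; the terms
    \<open>d n\<close> of the Neumann series then decay geometrically.\<close>
  define r where "r = (1 - c) / cmod z"
  have z0: "cmod z > 0" using z c_le_1 by linarith
  have r: "0 \<le> r" "r < 1" using z z0 c_le_1 by (auto simp: r_def)
  obtain B where B: "\<And>x. cmod (g x) \<le> B" using g by (auto simp: torus_bounded_def)
  have S_bounded: "torus_bounded (S f)" if "torus_bounded f" for f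
    using torus_bounded_mult_left[OF R_bounded[OF torus_bounded_imp_L1[OF that]], of "1 / z"]
    by (simp add: S_def[abs_def])
  have S_le: "cmod (S f x) \<le> r * M" if "torus_bounded f" "\<And>x. cmod (f x) \<le> M" for f M x
    using divide_right_mono[OF R_contraction[OF that, of x], of "cmod z"] by (simp add: S_def r_def norm_divide)
  have S_add: "S (\<lambda>x. f x + f' x) x = S f x + S f' x" if "torus_bounded f" "torus_bounded f'" for f f' x
    using that by (simp add: S_def R_add torus_bounded_imp_L1 add_divide_distrib)
  define d where "d n = (S ^^ n) g" for n
  have d_Suc: "d (Suc n) = S (d n)" and d_0: "d 0 = g" for n by (simp_all add: d_def)
  have d_bounded: "torus_bounded (d n)" for n
    by (induction n) (auto simp: d_Suc d_0 g S_bounded)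
  have d_le: "cmod (d n x) \<le> r ^ n * B" for n x
    by (induction n arbitrary: x) (auto simp: d_Suc d_0 B mult.assoc intro: S_le[OF d_bounded])
  define s where "s N x = (\<Sum>n<N. d n x)" for N x
  define u where "u x = (\<Sum>n. d n x)" for x
  have geo: "summable (\<lambda>n. r ^ n * B)" using r by (simp add: summable_mult2)
  have norm_sum: "summable (\<lambda>n. norm (d n x))" for x
    by (rule summable_comparison_test'[OF geo, of 0]) (simp add: d_le)
  have s_bounded: "torus_bounded (s N)" for N
    by (induction N) (simp_all add: s_def[abs_def] torus_bounded_const torus_bounded_add d_bounded)
  have s_Suc: "s (Suc N) x = g x + S (s N) x" for N x
  proof (induction N arbitrary: x)
    case 0
    \<comment> \<open>The empty sum \<open>s 0\<close> is the zero function, which \<open>S\<close>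
      annihilates by \<open>R_const\<close> with constant \<open>0\<close>.\<close>
    then show ?case by (simp add: s_def d_0 S_def R_const)
  next
    case (Suc N)
    have eq: "s (Suc N) = (\<lambda>x. s N x + d N x)" for N by (simp add: s_def fun_eq_iff)
    have "s (Suc (Suc N)) x = s (Suc N) x + S (d N) x" by (simp add: s_def d_Suc)
    also have "\<dots> = g x + (S (s N) x + S (d N) x)" using Suc by simp
    also have "\<dots> = g x + S (s (Suc N)) x" by (simp add: eq S_add s_bounded d_bounded)
    finally show ?case .
  qed
  have s_lim: "(\<lambda>N. s N x) \<longlonglongrightarrow> u x" for x
    unfolding s_def u_def by (rule summable_LIMSEQ[OF summable_norm_cancel[OF norm_sum]])
  have tail: "cmod (u x - s N x) \<le> r ^ N * (B / (1 - r))" for x N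
  proof -
    have "u x - s N x = (\<Sum>n. d (n + N) x)"
      unfolding u_def s_def using suminf_minus_initial_segment[OF summable_norm_cancel[OF norm_sum]] by simp
    also have "cmod \<dots> \<le> (\<Sum>n. r ^ N * B * r ^ n)"
    proof (rule norm_suminf_le)
      show "norm (d (n + N) x) \<le> r ^ N * B * r ^ n" for n
        using d_le[of "n + N" x] by (simp add: power_add mult_ac)
      show "summable (\<lambda>n. r ^ N * B * r ^ n)" using r by (intro summable_mult) simp
    qed
    also have "\<dots> = r ^ N * (B / (1 - r))"
      using r by (simp add: suminf_mult suminf_geometric)
    finally show ?thesis .
  qed
  have u_bounded: "torus_bounded u"
    unfolding torus_bounded_def
  proof (intro conjI exI allI)
    show "periodic_Zn u" using d_bounded by (simp add: u_def torus_bounded_def periodic_Zn_def)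
    show "u \<in> borel_measurable borel"
      by (rule borel_measurable_LIMSEQ_metric[OF _ s_lim]) (use s_bounded in \<open>auto simp: torus_bounded_def\<close>)
    show "cmod (u x) \<le> B / (1 - r)" for x
      using tail[of x 0] by (simp add: s_def)
  qed
  \<comment> \<open>The tail bound is uniform in \<open>x\<close>, so the contraction estimate
    applies to the remainder. This stands in for an exchange of \<open>S\<close> with the infinite
    sum.\<close>
  have S_tail: "cmod (S u x - S (s N) x) \<le> r ^ N * (B / (1 - r))" for x N
  proof -
    let ?e = "\<lambda>x. u x + (- 1) * s N x"
    have e: "torus_bounded ?e"
      by (intro torus_bounded_add torus_bounded_mult_left u_bounded s_bounded)
    have "cmod (S ?e x) \<le> r * (r ^ N * (B / (1 - r)))"
      using S_le[OF e, of "r ^ N * (B / (1 - r))"] tail by simp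
    also have "\<dots> \<le> 1 * (r ^ N * (B / (1 - r)))"
      using r order_trans[OF norm_ge_zero tail] by (intro mult_right_mono) auto
    finally have "cmod (S ?e x) \<le> r ^ N * (B / (1 - r))" by simp
    moreover have "S ?e x = S u x - S (s N) x"
      using S_add[OF u_bounded torus_bounded_mult_left[OF s_bounded], of "- 1" N x]
        R_mult_left[of "- 1" "s N" x] by (simp add: S_def)
    ultimately show ?thesis by simp
  qed
  \<comment> \<open>Both sides of the recursion \<open>s_Suc\<close> converge pointwise, and limits
    are unique.\<close>
  have "u x = g x + S u x" for x
  proof (rule LIMSEQ_unique)
    show "(\<lambda>N. s (Suc N) x) \<longlonglongrightarrow> u x" using s_lim by (rule LIMSEQ_Suc)
    have "(\<lambda>N. r ^ N) \<longlonglongrightarrow> 0"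
      using r by (intro LIMSEQ_power_zero) simp
    then have lim: "(\<lambda>N. r ^ N * (B / (1 - r))) \<longlonglongrightarrow> 0"
      by (rule tendsto_mult_left_zero)
    have "norm (S (s N) x - S u x) \<le> r ^ N * (B / (1 - r))" for N
      using S_tail[where x=x and N=N] by (simp only: norm_minus_commute)
    then have "(\<lambda>N. S (s N) x - S u x) \<longlonglongrightarrow> 0"
      by (intro Lim_null_comparison[OF _ lim] always_eventually) simp
    then have "(\<lambda>N. S (s N) x) \<longlonglongrightarrow> S u x" by (rule LIM_zero_cancel)
    then show "(\<lambda>N. s (Suc N) x) \<longlonglongrightarrow> g x + S u x" unfolding s_Suc by (intro tendsto_intros)
  qed
  with u_bounded show ?thesis by (intro that) (auto simp: S_def)
qed

section \<open>Resolvent and eigenfunctions of the kernel operator\<close>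

lemma T_resolvent_bounded:
  assumes w: "torus_bounded w" and z: "cmod z > 1 - c" "z \<noteq> 1"
  obtains u where "torus_bounded u" "\<And>x. T u x - z * u x = w x"
proof -
  have z0: "z \<noteq> 0" using z c_le_1 by auto
  obtain v where v: "torus_bounded v" "\<And>x. v x = - (1 / z) * w x + R v x / z"
    using R_fixed_point[OF torus_bounded_mult_left[OF w, of "- (1 / z)"] z(1)] by blast
  have Rv: "R v x - z * v x = w x" for x
    using v(2)[of x] z0 by (simp add: field_simps)
  \<comment> \<open>\<open>v\<close> already solves the equation with \<open>R\<close> in place of
    \<open>T\<close>; the error is the constant \<open>c\<close> times the mean of \<open>v\<close>.
    Adding a constant \<open>k\<close> contributes \<open>(1 - z) * k\<close>, which cancels this
    error when \<open>z\<close> is not \<open>1\<close>.\<close>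
  define k where "k = - complex_of_real c * cube_mean v / (1 - z)"
  have k: "(1 - z) * k = - complex_of_real c * cube_mean v" using z by (simp add: k_def)
  show ?thesis
  proof (rule that)
    show "torus_bounded (\<lambda>x. v x + k)" by (intro torus_bounded_add v torus_bounded_const)
    fix x
    have "T (\<lambda>x. v x + k) x = T v x + k"
      using T_add[OF torus_bounded_imp_L1[OF v(1)] torus_bounded_imp_L1[OF torus_bounded_const]] by (simp add: T_const)
    then have "T (\<lambda>x. v x + k) x - z * (v x + k) = (R v x - z * v x) + complex_of_real c * cube_mean v + (1 - z) * k"
      by (simp add: R_def algebra_simps)
    then show "T (\<lambda>x. v x + k) x - z * (v x + k) = w x" by (simp add: Rv k)
  qed
qed

text \<open>The sup norm \<open>s\<close> of such a \<open>u\<close> satisfies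
  \<open>cmod z * s \<le> (1 - c) * s\<close>, which leaves only \<open>s = 0\<close>.\<close>

lemma R_eigenfunction_zero:
  assumes u: "torus_bounded u" and eq: "\<And>x. R u x = z * u x" and z: "cmod z > 1 - c"
  shows "u x = 0"
proof -
  obtain B where B: "\<And>x. cmod (u x) \<le> B" using u by (auto simp: torus_bounded_def)
  define s where "s = (SUP x. cmod (u x))"
  have le: "cmod (u x) \<le> s" for x
    unfolding s_def by (rule cSUP_upper) (auto intro!: bdd_aboveI2[where M=B] B)
  have z0: "cmod z > 0" using z c_le_1 by linarith
  have "s \<le> (1 - c) / cmod z * s"
    unfolding s_def
  proof (rule cSUP_least, simp)
    fix x
    have "cmod z * cmod (u x) \<le> (1 - c) * s"
      using R_contraction[OF u le, of x] by (simp add: eq norm_mult)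
    then show "cmod (u x) \<le> (1 - c) / cmod z * (SUP x. cmod (u x))"
      using z0 by (simp add: s_def field_simps)
  qed
  then have "(cmod z - (1 - c)) * s \<le> 0" using z0 by (simp add: field_simps)
  then have "s \<le> 0" using z by (simp add: mult_le_0_iff)
  then have "cmod (u x) \<le> 0" using le[of x] by linarith
  then show ?thesis by simp
qed

text \<open>The image \<open>w = T f\<close> is bounded and satisfies the eigenvalue equation at
  every point. A suitable constant turns it into an eigenfunction of \<open>R\<close>, which must
  vanish, so \<open>w\<close> is constant and with it \<open>f\<close>.\<close>

lemma T_eigenfunction_const:
  assumes f: "torus_L1 f" and z: "cmod z > 1 - c" and eq: "ae_eq (T f) (\<lambda>x. z * f x)"
  obtains b where "ae_eq f (\<lambda>_. b)" "z \<noteq> 1 \<Longrightarrow> b = 0"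
proof -
  have z0: "z \<noteq> 0" using z c_le_1 by auto
  define w where "w = T f"
  have w: "torus_bounded w" unfolding w_def by (rule T_bounded[OF f])
  have Tw: "T w x = z * w x" for x
    using T_ae_cong[OF torus_bounded_imp_L1[OF w] torus_L1_mult_left[OF f, of z]] eq
    by (simp add: w_def T_mult_left)
  have nz: "1 - complex_of_real c - z \<noteq> 0"
  proof
    assume "1 - complex_of_real c - z = 0"
    then have "z = complex_of_real (1 - c)" by simp
    then have "cmod z = 1 - c" using c_le_1 by (simp only: norm_of_real)
    then show False using z by simp
  qed
  \<comment> \<open>Comparing \<open>R (w + k) = z w - c * mean w + (1 - c) k\<close> with
    \<open>z (w + k)\<close> gives this value of \<open>k\<close>.\<close>
  define k where "k = complex_of_real c * cube_mean w / (1 - complex_of_real c - z)"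
  have k: "(1 - complex_of_real c - z) * k = complex_of_real c * cube_mean w" using nz by (simp add: k_def)
  have wk: "torus_bounded (\<lambda>x. w x + k)" by (intro torus_bounded_add w torus_bounded_const)
  have "R (\<lambda>x. w x + k) x = z * (w x + k)" for x
  proof -
    have "R (\<lambda>x. w x + k) x = R w x + (1 - complex_of_real c) * k"
      using R_add[OF torus_bounded_imp_L1[OF w] torus_bounded_imp_L1[OF torus_bounded_const]] by (simp add: R_const)
    also have "\<dots> = z * (w x + k)" using k by (simp add: R_def Tw algebra_simps)
    finally show ?thesis .
  qed
  from R_eigenfunction_zero[OF wk this z] have w_const: "w = (\<lambda>_. - k)"
    by (simp add: fun_eq_iff eq_neg_iff_add_eq_0)
  show ?thesis
  proof (rule that)
    show "ae_eq f (\<lambda>_. - k / z)"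
      using eq unfolding ae_eq_def w_def[symmetric] w_const
      by (rule AE_mp) (use z0 in \<open>auto intro!: AE_I2 simp: field_simps\<close>)
    \<comment> \<open>\<open>T\<close> fixes constants, so a nonzero constant eigenfunction is
      possible only for \<open>z = 1\<close>.\<close>
    have "- k = z * (- k)" using Tw[of 0] unfolding w_const by (simp only: T_const)
    then show "- k / z = 0" if "z \<noteq> 1" using that by auto
  qed
qed

end

section \<open>The Lagrangian kernel satisfies the Doeblin conditions\<close>

lemma doeblin_kernel_gam:
  fixes U phi :: "real^'n \<Rightarrow> real" and P :: "real^'n"
  assumes U: "continuous_on UNIV U" "periodic_Zn U"
    and phi: "continuous_on UNIV phi" "periodic_Zn phi"
    and eps: "eps > 0" and h: "h > 0"
    and phi_eq: "\<And>x. - eps * h * ln (\<integral>v. exp (- (h * Lag U P x v + phi (x + h *\<^sub>R v)) / (eps * h)) \<partial>lborel)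
                    = phi x + lam"
  obtains C a c where "doeblin_kernel (gam U P eps h phi lam) h C a c"
proof -
  let ?k = "gam U P eps h phi lam"
  obtain BU where BU: "\<And>x. \<bar>U x\<bar> \<le> BU" using continuous_periodic_bounded[OF U] by blast
  obtain Bp where Bp: "\<And>x. \<bar>phi x\<bar> \<le> Bp" using continuous_periodic_bounded[OF phi] by blast
  define E where "E = h * (norm P)\<^sup>2 + h * BU + 2 * Bp + \<bar>lam\<bar>"
  define C where "C = exp (E / (eps * h))"
  \<comment> \<open>Half of the kinetic term survives in the upper bound:
    \<open>h * |v|^2 / 4\<close> divided by \<open>eps * h\<close>.\<close>
  define a where "a = 1 / (4 * eps)"
  \<comment> \<open>Points of the cube are at most \<open>2 * M\<close> apart, so \<open>V\<close>
    bounds every velocity joining two of them in time \<open>h\<close>, and \<open>F\<close> bounds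
    the action expression for such velocities. Dividing by \<open>h ^ CARD('n)\<close> in
    \<open>c\<close> offsets the Jacobian in the minorization.\<close>
  obtain M where M: "M > 0" "\<And>t::real^'n. t \<in> torus_cube \<Longrightarrow> norm t \<le> M"
    using bounded_cbox[of "0::real^'n" One] unfolding torus_cube_def bounded_pos by blast
  define V where "V = 2 * M / h"
  define F where "F = h * (V\<^sup>2 / 2 + norm P * V) + h * BU + 2 * Bp + \<bar>lam\<bar>"
  define c where "c = exp (- F / (eps * h)) / h ^ CARD('n)"
  have hU: "\<bar>h * U x\<bar> \<le> h * BU" for x using BU[of x] h by (simp add: abs_mult)
  have up: "?k x v \<le> C * exp (- a * (norm v)\<^sup>2)" for x v
  proof -
    \<comment> \<open>Completing the square: the other half of the kinetic term absorbs
      \<open>P \<bullet> v\<close> at the cost of \<open>(norm P)\<^sup>2\<close>.\<close>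
    have "0 \<le> (norm v / 2 - norm P)\<^sup>2" by simp
    then have "(norm v)\<^sup>2 / 4 - norm v * norm P + (norm P)\<^sup>2 \<ge> 0"
      by (simp add: power2_diff power_divide)
    moreover have "\<bar>P \<bullet> v\<bar> \<le> norm v * norm P" using Cauchy_Schwarz_ineq2[of P v] by (simp add: mult.commute)
    ultimately have "(norm v)\<^sup>2 / 2 + P \<bullet> v \<ge> (norm v)\<^sup>2 / 4 - (norm P)\<^sup>2" by linarith
    then have "h * ((norm v)\<^sup>2 / 2 + P \<bullet> v) \<ge> h * ((norm v)\<^sup>2 / 4 - (norm P)\<^sup>2)"
      using h by (intro mult_left_mono) auto
    then have "- (h * Lag U P x v + phi (x + h *\<^sub>R v) - phi x - lam) \<le> E - h * (norm v)\<^sup>2 / 4"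
      using hU[of x] Bp[of x] Bp[of "x + h *\<^sub>R v"] by (simp add: Lag_def E_def algebra_simps abs_le_iff) linarith
    then have "- (h * Lag U P x v + phi (x + h *\<^sub>R v) - phi x - lam) / (eps * h) \<le> (E - h * (norm v)\<^sup>2 / 4) / (eps * h)"
      using eps h by (intro divide_right_mono) auto
    also have "\<dots> = E / (eps * h) + - a * (norm v)\<^sup>2" using eps h by (simp add: a_def field_simps)
    finally show ?thesis unfolding gam_def C_def exp_add[symmetric] by simp
  qed
  have low: "exp (- F / (eps * h)) \<le> ?k x v" if "x \<in> torus_cube" "x + h *\<^sub>R v \<in> torus_cube" for x v
  proof -
    have "h * norm v = norm ((x + h *\<^sub>R v) - x)" using h by simp
    also have "\<dots> \<le> 2 * M" using M(2)[OF that(1)] M(2)[OF that(2)] norm_triangle_ineq4[of "x + h *\<^sub>R v" x] by linarith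
    finally have v: "norm v \<le> V" using h by (simp add: V_def field_simps)
    then have "(norm v)\<^sup>2 \<le> V\<^sup>2" by (simp add: power_mono)
    moreover have "P \<bullet> v \<le> norm P * V"
      using Cauchy_Schwarz_ineq2[of P v] mult_left_mono[OF v, of "norm P"] by simp
    ultimately have "(norm v)\<^sup>2 / 2 + P \<bullet> v \<le> V\<^sup>2 / 2 + norm P * V" by linarith
    then have "h * ((norm v)\<^sup>2 / 2 + P \<bullet> v) \<le> h * (V\<^sup>2 / 2 + norm P * V)"
      using h by (intro mult_left_mono) auto
    then have "- F \<le> - (h * Lag U P x v + phi (x + h *\<^sub>R v) - phi x - lam)"
      using hU[of x] Bp[of x] Bp[of "x + h *\<^sub>R v"] by (simp add: Lag_def F_def algebra_simps abs_le_iff) linarith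
    then have "- F / (eps * h) \<le> - (h * Lag U P x v + phi (x + h *\<^sub>R v) - phi x - lam) / (eps * h)"
      using eps h by (intro divide_right_mono) auto
    then show ?thesis unfolding gam_def by (simp only: exp_le_cancel_iff)
  qed
  have meas: "(\<lambda>(x, v). ?k x v) \<in> borel_measurable (lborel \<Otimes>\<^sub>M lborel)"
  proof -
    have [measurable]: "U \<in> borel_measurable borel" "phi \<in> borel_measurable borel"
      using U phi by (auto intro: borel_measurable_continuous_onI)
    show ?thesis unfolding gam_def Lag_def by measurable
  qed
  have a: "a > 0" using eps by (simp add: a_def)
  have int: "integrable lborel (?k x)" for x
  proof (rule integrableI_bounded)
    show "?k x \<in> borel_measurable lborel"
      using measurable_Pair2[OF meas, of x] by simp
    have "(\<integral>\<^sup>+v. ennreal (norm (?k x v)) \<partial>lborel) \<le> (\<integral>\<^sup>+v. ennreal C * ennreal (exp (- a * (norm (v::real^'n))\<^sup>2)) \<partial>lborel)"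
    proof (rule nn_integral_mono)
      fix v
      have "norm (?k x v) = ?k x v" by (simp add: gam_def)
      then show "ennreal (norm (?k x v)) \<le> ennreal C * ennreal (exp (- a * (norm v)\<^sup>2))"
        using ennreal_leI[OF up[of x v]] by (simp add: C_def ennreal_mult)
    qed
    also have "\<dots> = ennreal C * (\<integral>\<^sup>+v. ennreal (exp (- a * (norm (v::real^'n))\<^sup>2)) \<partial>lborel)"
      by (rule nn_integral_cmult) measurable
    also have "\<dots> < \<infinity>"
      using nn_integral_gaussian_finite[OF a, where 'a="real^'n"] by (simp add: ennreal_mult_less_top)
    finally show "(\<integral>\<^sup>+v. ennreal (norm (?k x v)) \<partial>lborel) < \<infinity>" .
  qed
  have int1: "(\<integral>v. ?k x v \<partial>lborel) = 1" for x
  proof -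
    let ?I = "\<integral>v. exp (- (h * Lag U P x v + phi (x + h *\<^sub>R v)) / (eps * h)) \<partial>lborel"
    let ?e = "exp ((phi x + lam) / (eps * h))"
    have "?k x v = exp (- (h * Lag U P x v + phi (x + h *\<^sub>R v)) / (eps * h)) * ?e" for v
      by (simp add: gam_def exp_add[symmetric] add_divide_distrib[symmetric] algebra_simps)
    then have eq: "(\<integral>v. ?k x v \<partial>lborel) = ?I * ?e" by simp
    \<comment> \<open>Before \<open>ln\<close> can be inverted in the equation for
      \<open>phi\<close>, its argument must be known to be positive. It is not zero, since the
      kernel is integrable and positive everywhere.\<close>
    have "(\<integral>v. ?k x v \<partial>lborel) \<noteq> 0"
    proof
      assume "(\<integral>v. ?k x v \<partial>lborel) = 0"
      moreover have "AE v in lborel. 0 \<le> ?k x v" by (simp add: gam_def)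
      ultimately have "AE v in lborel. ?k x v = 0"
        using integral_nonneg_eq_0_iff_AE[OF int[of x]] by blast
      then have "AE v in (lborel :: (real^'n) measure). False" by (simp add: gam_def)
      then show False by (simp add: AE_iff_null null_sets_def)
    qed
    moreover have "(\<integral>v. ?k x v \<partial>lborel) \<ge> 0" by (simp add: gam_def)
    ultimately have I: "?I > 0" using eq by (simp add: zero_less_mult_iff less_le)
    have "ln ?I = - ((phi x + lam) / (eps * h))" using phi_eq[of x] eps h by (simp add: field_simps)
    then have "exp (- ((phi x + lam) / (eps * h))) = ?I" using exp_ln[OF I] by (simp only:)
    then show ?thesis unfolding eq by (metis exp_minus_inverse mult.commute)
  qed
  have per: "periodic_Zn (\<lambda>x. ?k x v)" for v
    unfolding periodic_Zn_def
  proof (intro allI impI)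
    fix x k :: "real^'n" assume k: "\<forall>i. k $ i \<in> \<int>"
    have "x + k + h *\<^sub>R v = (x + h *\<^sub>R v) + k" by simp
    moreover have "U (y + k) = U y" "phi (y + k) = phi y" for y
      using U phi k by (simp_all add: periodic_Zn_def)
    ultimately show "?k (x + k) v = ?k x v" by (simp only: gam_def Lag_def)
  qed
  have "doeblin_kernel ?k h C a c"
  proof
    show "0 \<le> ?k x v" for x v by (simp add: gam_def)
    show "0 < c" using h by (simp add: c_def)
    show "c * h ^ CARD('n) \<le> ?k x v" if "x \<in> torus_cube" "x + h *\<^sub>R v \<in> torus_cube" for x v
      using low[OF that] h by (simp add: c_def)
  qed (fact h a meas up per int1)+
  then show ?thesis by (rule that)
qed

section \<open>The weighted space between bounded and integrable functions\<close>

lemma L2w_add: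
  assumes "L2w \<theta> f" "L2w \<theta> g" and [measurable]: "\<theta> \<in> borel_measurable borel" and "\<And>x. \<theta> x \<ge> 0"
  shows "L2w \<theta> (\<lambda>x. f x + g x)"
proof -
  have [measurable]: "f \<in> borel_measurable borel" "g \<in> borel_measurable borel"
    using assms by (auto simp: L2w_def)
  have "set_integrable lborel torus_cube (\<lambda>x. 2 * (\<theta> x * (cmod (f x))\<^sup>2) + 2 * (\<theta> x * (cmod (g x))\<^sup>2))"
    using assms by (auto simp: L2w_def)
  then have "set_integrable lborel torus_cube (\<lambda>x. \<theta> x * (cmod (f x + g x))\<^sup>2)"
    unfolding set_integrable_def
  proof (rule Bochner_Integration.integrable_bound)
    have "\<theta> x * (cmod (f x + g x))\<^sup>2 \<le> 2 * (\<theta> x * (cmod (f x))\<^sup>2) + 2 * (\<theta> x * (cmod (g x))\<^sup>2)" for x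
    proof -
      have "(cmod (f x + g x))\<^sup>2 \<le> (cmod (f x) + cmod (g x))\<^sup>2" by (intro power_mono norm_triangle_ineq) simp
      also have "\<dots> \<le> 2 * (cmod (f x))\<^sup>2 + 2 * (cmod (g x))\<^sup>2"
        using sum_squares_bound[of "cmod (f x)" "cmod (g x)"] by (simp add: power2_sum)
      finally have "\<theta> x * (cmod (f x + g x))\<^sup>2 \<le> \<theta> x * (2 * (cmod (f x))\<^sup>2 + 2 * (cmod (g x))\<^sup>2)"
        using assms(4) by (rule mult_left_mono)
      then show ?thesis by (simp add: algebra_simps)
    qed
    then show "AE x in lborel. norm (indicator torus_cube x *\<^sub>R (\<theta> x * (cmod (f x + g x))\<^sup>2))
      \<le> norm (indicator torus_cube x *\<^sub>R (2 * (\<theta> x * (cmod (f x))\<^sup>2) + 2 * (\<theta> x * (cmod (g x))\<^sup>2)))"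
      using assms(4) by (auto intro!: AE_I2 split: split_indicator intro: order_trans[OF _ abs_ge_self])
  qed measurable
  with assms(1,2) show ?thesis by (auto simp: L2w_def periodic_Zn_def)
qed

lemma L2w_mult_left:
  assumes "L2w \<theta> f"
  shows "L2w \<theta> (\<lambda>x. k * f x)"
proof -
  have "set_integrable lborel torus_cube (\<lambda>x. (cmod k)\<^sup>2 * (\<theta> x * (cmod (f x))\<^sup>2))"
    using assms by (auto simp: L2w_def)
  then have "set_integrable lborel torus_cube (\<lambda>x. \<theta> x * (cmod (k * f x))\<^sup>2)"
    by (simp add: norm_mult power_mult_distrib mult_ac)
  with assms show ?thesis by (auto simp: L2w_def periodic_Zn_def)
qed

lemma torus_bounded_imp_L2w:
  fixes f :: "real^'n \<Rightarrow> complex"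
  assumes "torus_bounded f" and [measurable]: "\<theta> \<in> borel_measurable borel" and \<theta>: "\<And>x. \<theta> x \<ge> 0" "\<And>x. \<theta> x \<le> M"
  shows "L2w \<theta> f"
proof -
  obtain B where B: "\<And>x. cmod (f x) \<le> B" and [measurable]: "f \<in> borel_measurable borel"
    using assms by (auto simp: torus_bounded_def)
  have "\<bar>\<theta> x * (cmod (f x))\<^sup>2\<bar> \<le> M * B\<^sup>2" for x
    using \<theta>[of x] B[of x] by (auto simp: abs_mult intro!: mult_mono power_mono)
  then have "set_integrable lborel torus_cube (\<lambda>x. \<theta> x * (cmod (f x))\<^sup>2)"
    unfolding set_integrable_def
    by (intro integrableI_bounded_set[where A=torus_cube and B="M * B\<^sup>2"]) auto
  with assms show ?thesis by (simp add: L2w_def torus_bounded_def)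
qed

text \<open>On the cube, which has measure one, \<open>|f|\<close> is dominated by
  \<open>1 + |f|^2\<close>, and the lower bound \<open>m\<close> trades the plain square for the
  weighted one.\<close>

lemma L2w_imp_torus_L1:
  fixes f :: "real^'n \<Rightarrow> complex"
  assumes f: "L2w \<theta> f" and m: "m > 0" "\<And>x. m \<le> \<theta> x"
  shows "torus_L1 f"
proof -
  have [measurable]: "f \<in> borel_measurable borel" using f by (simp add: L2w_def)
  have "set_integrable lborel torus_cube (\<lambda>x::real^'n. 1::real)"
    unfolding set_integrable_def
    by (rule integrableI_bounded_set[where A=torus_cube and B=1]) auto
  then have "set_integrable lborel torus_cube (\<lambda>x. 1 + (1 / m) * (\<theta> x * (cmod (f x))\<^sup>2))"
    using f by (intro set_integral_add(1) set_integrable_mult_right) (auto simp: L2w_def)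
  then have "set_integrable lborel torus_cube f"
    unfolding set_integrable_def
  proof (rule Bochner_Integration.integrable_bound)
    have "cmod (f x) \<le> 1 + (1 / m) * (\<theta> x * (cmod (f x))\<^sup>2)" for x
    proof -
      have "cmod (f x) \<le> 1 + (cmod (f x))\<^sup>2"
        using sum_squares_bound[of 1 "cmod (f x)"] norm_ge_zero[of "f x"] by (simp only: mult_1_right one_power2)
      moreover have "1 * (cmod (f x))\<^sup>2 \<le> (\<theta> x / m) * (cmod (f x))\<^sup>2"
        using m by (intro mult_right_mono) auto
      ultimately show ?thesis by simp
    qed
    then show "AE x in lborel. norm (indicator torus_cube x *\<^sub>R f x)
      \<le> norm (indicator torus_cube x *\<^sub>R (1 + (1 / m) * (\<theta> x * (cmod (f x))\<^sup>2)))"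
      by (auto intro!: AE_I2 split: split_indicator intro: order_trans[OF _ abs_ge_self])
  qed measurable
  with f show ?thesis by (simp add: L2w_def torus_L1_def)
qed

lemma ae_eq_const_iff: "ae_eq (\<lambda>_::real^'n. b) (\<lambda>_. b') \<longleftrightarrow> b = b'"
proof
  assume "ae_eq (\<lambda>_::real^'n. b) (\<lambda>_. b')"
  then have *: "AE x in lborel. (x::real^'n) \<in> torus_cube \<longrightarrow> b = b'" by (simp only: ae_eq_def)
  show "b = b'"
  proof (rule ccontr)
    assume "b \<noteq> b'"
    with * have "AE x in lborel. (x::real^'n) \<notin> torus_cube" by simp
    then have "emeasure lborel (torus_cube :: (real^'n) set) = 0"
      by (subst (asm) AE_iff_null) (auto simp: null_sets_def)
    then show False by simp
  qed
qed (simp add: ae_eq_def)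

section \<open>Eigenvalue one and the spectral gap in the weighted space\<close>

theorem mainTheorem3:
  fixes U :: "real^'n \<Rightarrow> real" and P :: "real^'n"
    and eps h lam :: real and phi phibar :: "real^'n \<Rightarrow> real"
  defines "\<theta> \<equiv> (\<lambda>x. exp (- (phi x + phibar x) / (eps * h)))"
    and "F \<equiv> Fop U P eps h phi lam"
  assumes U_smooth: "smooth_torus U"
    and eps_pos: "eps > 0" and h_pos: "h > 0"
    and phi_per: "periodic_Zn phi" and phi_diff: "\<forall>x. phi differentiable (at x)"
    and phibar_per: "periodic_Zn phibar" and phibar_diff: "\<forall>x. phibar differentiable (at x)"
    and phi_eq: "\<forall>x. - eps * h * ln (\<integral>v. exp (- (h * Lag U P x v + phi (x + h *\<^sub>R v)) / (eps * h)) \<partial>lborel)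
                    = phi x + lam"
    and phibar_eq: "\<forall>x. - eps * h * ln (\<integral>v. exp (- (h * Lag U P (x + h *\<^sub>R v) (- v) + phibar (x + h *\<^sub>R v)) / (eps * h)) \<partial>lborel)
                    = phibar x + lam"
    and theta_prob: "(LINT x:torus_cube|lborel. \<theta> x) = 1"
    and unique_pos_eig: "\<forall>g :: real^'n \<Rightarrow> real. periodic_Zn g \<longrightarrow>
                           (\<forall>x. F (\<lambda>y. complex_of_real (exp (- g y))) x = complex_of_real (exp (- g x)))
                           \<longrightarrow> (\<exists>c. \<forall>x. g x = c)"
  shows "is_eigenvalue_L2 \<theta> F 1
       \<and> (\<forall>f. L2w \<theta> f \<longrightarrow> ae_eq (F f) f \<longrightarrow> (\<exists>c. ae_eq f (\<lambda>_. c)))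
       \<and> (\<exists>\<delta>>0. \<forall>z. 0 < cmod (z - 1) \<and> cmod (z - 1) < \<delta> \<longrightarrow> z \<notin> spectrum_L2 \<theta> F)
       \<and> \<not> (\<exists>lp fp. lp \<longlonglongrightarrow> 1 \<and>
              (\<forall>p. L2w \<theta> (fp p) \<and> ae_eq (F (fp p)) (\<lambda>x. lp p * fp p x)
                   \<and> L2w_norm \<theta> (fp p) = 1
                   \<and> (LINT x:torus_cube|lborel. fp p x * complex_of_real (\<theta> x)) = 0))"
proof -
  have cont_phi: "continuous_on UNIV phi" and cont_phibar: "continuous_on UNIV phibar"
    using phi_diff phibar_diff
    by (auto intro!: continuous_at_imp_continuous_on differentiable_imp_continuous_within)
  have U: "continuous_on UNIV U" "periodic_Zn U"
    using U_smooth Ck.simps(1) by (auto simp: smooth_torus_def simp del: Ck.simps)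
  obtain C a c where "doeblin_kernel (gam U P eps h phi lam) h C a c"
    using doeblin_kernel_gam[OF U cont_phi phi_per eps_pos h_pos] phi_eq by blast
  then interpret doeblin_kernel "gam U P eps h phi lam" h C a c .
  have F_eq: "F = T"
    by (simp add: F_def fun_eq_iff Fop_def T_def)

  \<comment> \<open>Continuity and periodicity of the exponent keep \<open>\<theta>\<close> between
    two positive constants, which gives the inclusions \<open>L1\<close> and \<open>L2\<close>
    between the function classes.\<close>
  have cont_sum: "continuous_on UNIV (\<lambda>x. - (phi x + phibar x) / (eps * h))"
    by (intro continuous_intros cont_phi cont_phibar) (use eps_pos h_pos in auto)
  have per_sum: "periodic_Zn (\<lambda>x. - (phi x + phibar x) / (eps * h))"
    using phi_per phibar_per by (simp add: periodic_Zn_def)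
  obtain B where B: "\<And>x. \<bar>- (phi x + phibar x) / (eps * h)\<bar> \<le> B"
    using continuous_periodic_bounded[OF cont_sum per_sum] by blast
  have \<theta>_ge: "exp (- B) \<le> \<theta> x" and \<theta>_le: "\<theta> x \<le> exp B" and \<theta>_nonneg: "0 \<le> \<theta> x" for x
    using B[of x] unfolding \<theta>_def exp_le_cancel_iff abs_le_iff by auto
  have \<theta>_borel [measurable]: "\<theta> \<in> borel_measurable borel"
    unfolding \<theta>_def using borel_measurable_continuous_onI[OF cont_sum] by measurable
  have L1: "torus_L1 f" if "L2w \<theta> f" for f
    using L2w_imp_torus_L1[OF that, of "exp (- B)"] \<theta>_ge by simp
  have L2: "L2w \<theta> f" if "torus_bounded f" for f
    using that \<theta>_borel \<theta>_nonneg \<theta>_le by (rule torus_bounded_imp_L2w)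
  \<comment> \<open>The gap has radius \<open>c\<close>: by the triangle inequality the disc of that
    radius around \<open>1\<close> lies where the resolvent and eigenfunction results apply.\<close>
  have near_1: "cmod z > 1 - c" if "cmod (z - 1) < c" for z
    using that norm_triangle_ineq2[of 1 "1 - z"] by (simp add: norm_minus_commute)
  have eigen: "\<exists>b. ae_eq f (\<lambda>_. b) \<and> (z \<noteq> 1 \<longrightarrow> b = 0)"
    if "L2w \<theta> f" "cmod (z - 1) < c" "ae_eq (F f) (\<lambda>x. z * f x)" for f z
    using T_eigenfunction_const[OF L1[OF that(1)] near_1[OF that(2)]] that(3) by (metis F_eq)

  have "ae_eq (F (\<lambda>_. 1)) (\<lambda>x. 1 * 1)"
    by (simp add: F_eq T_const ae_eq_def)
  then have A: "is_eigenvalue_L2 \<theta> F 1"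
    unfolding is_eigenvalue_L2_def
    using L2[OF torus_bounded_const[of 1]] ae_eq_const_iff[of 1 0, where 'n='n] by auto

  have B: "\<forall>f. L2w \<theta> f \<longrightarrow> ae_eq (F f) f \<longrightarrow> (\<exists>c. ae_eq f (\<lambda>_. c))"
    using eigen[of _ 1] c_pos by auto

  have C: "z \<notin> spectrum_L2 \<theta> F" if z: "0 < cmod (z - 1)" "cmod (z - 1) < c" for z
  proof -
    have z1: "z \<noteq> 1" and zc: "cmod z > 1 - c" using z near_1 by auto
    have z0: "z \<noteq> 0" using zc c_le_1 by auto
    have "\<exists>f. L2w \<theta> f \<and> ae_eq (\<lambda>x. F f x - z * f x) g" if g: "L2w \<theta> g" for g
    proof -
      \<comment> \<open>\<open>F - z\<close> sends \<open>- g / z\<close> to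
        \<open>g - F g / z\<close>. The error \<open>F g / z\<close> is bounded even when
        \<open>g\<close> is not, so a bounded \<open>u\<close> can compensate for it.\<close>
      obtain u where u: "torus_bounded u" "\<And>x. T u x - z * u x = (1 / z) * T g x"
        using T_resolvent_bounded[OF torus_bounded_mult_left[OF T_bounded[OF L1[OF g]], of "1 / z"] zc z1] by blast
      let ?f = "\<lambda>x. u x + (- (1 / z)) * g x"
      have "F ?f x - z * ?f x = g x" for x
      proof -
        have "F ?f x = T u x + (- (1 / z)) * T g x"
          unfolding F_eq
          by (simp only: T_add[OF torus_bounded_imp_L1[OF u(1)] torus_L1_mult_left[OF L1[OF g]]] T_mult_left)
        then have "F ?f x - z * ?f x = (T u x - z * u x) - (1 / z) * T g x + g x"
          using z0 by (simp add: algebra_simps)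
        then show ?thesis by (simp add: u(2))
      qed
      moreover have "L2w \<theta> ?f"
        by (intro L2w_add L2w_mult_left L2 u g) (auto simp: \<theta>_nonneg)
      ultimately show ?thesis by (intro exI[of _ ?f]) (simp add: ae_eq_def)
    qed
    moreover have "ae_eq f (\<lambda>_. 0)" if "L2w \<theta> f" "ae_eq (\<lambda>x. F f x - z * f x) (\<lambda>_. 0)" for f
      using eigen[OF that(1) z(2)] that(2) z1 by (auto simp: ae_eq_def)
    ultimately show ?thesis by (simp add: spectrum_L2_def)
  qed

  have False if lp: "lp \<longlonglongrightarrow> 1" and fp: "\<forall>p. L2w \<theta> (fp p) \<and> ae_eq (F (fp p)) (\<lambda>x. lp p * fp p x)
                   \<and> L2w_norm \<theta> (fp p) = 1
                   \<and> (LINT x:torus_cube|lborel. fp p x * complex_of_real (\<theta> x)) = 0" for lp fp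
  proof -
    from lp c_pos obtain p where p: "cmod (lp p - 1) < c"
      by (metis LIMSEQ_D order_refl)
    have f: "L2w \<theta> (fp p)" using fp by blast
    then have [measurable]: "fp p \<in> borel_measurable borel" by (simp add: L2w_def)
    \<comment> \<open>The eigenvalue \<open>lp p\<close> may equal \<open>1\<close>, so only
      constancy is used. Zero mean against a probability density then forces \<open>b = 0\<close>,
      contradicting the unit norm.\<close>
    obtain b where b: "ae_eq (fp p) (\<lambda>_. b)" using eigen[OF f p] fp by blast
    have "0 = (LINT x:torus_cube|lborel. fp p x * complex_of_real (\<theta> x))" using fp by simp
    also have "\<dots> = (LINT x:torus_cube|lborel. b * complex_of_real (\<theta> x))"
      by (rule set_lebesgue_integral_cong_AE) (use b in \<open>auto simp: ae_eq_def\<close>)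
    also have "\<dots> = b * complex_of_real (LINT x:torus_cube|lborel. \<theta> x)"
      by (simp add: set_integral_complex_of_real)
    finally have "b = 0" using theta_prob by simp
    with b have "(LINT x:torus_cube|lborel. \<theta> x * (cmod (fp p x))\<^sup>2) = (LINT x:(torus_cube::(real^'n) set)|lborel. 0)"
      by (intro set_lebesgue_integral_cong_AE) (auto simp: ae_eq_def)
    then have "L2w_norm \<theta> (fp p) = 0" by (simp add: L2w_norm_def)
    then show False using fp by (metis zero_neq_one)
  qed
  with A B C c_pos show ?thesis by blast
qed

end
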